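(* Let $G$ be a finite abelian group. For every $f\in(\mathbb{C}^{o(G)})^*$ and $\tau\in\mathbb{C}^{o(G)}$, $$V_\tau W_f=o(G)\,f(\tau)\,I_{\mathbb{C}^{o(G)}}.$$
   Context: $G$ is a finite abelian group (written additively), $o(G)$ is its order, and $\widehat{G}$ is its group of characters. $\mathbb{C}^{o(G)}$ is the space of vectors $(x_g)_{g\in G}$, $(\mathbb{C}^{o(G)})^*$ is the space of linear functionals on it, and $I_{\mathbb{C}^{o(G)}}$ is the identity operator. For $\lambda=(k,\xi)\in G\times\widehat{G}$ the time-frequency shift operator $\pi(\lambda):\mathbb{C}^{o(G)}\to\mathbb{C}^{o(G)}$ is $\pi(\lambda)(x_g)_{g\in G}=(\xi(g)x_{g-k})_{g\in G}$; it is invertible. The analysis operator is $W_f:\mathbb{C}^{o(G)}\to\mathbb{C}^{o(G\times\widehat{G})}$, $W_fx=(f(\pi(\lambda)^{-1}x))_{\lambda\in G\times\widehat{G}}$, and the synthesis operator is $V_\tau:\mathbb{C}^{o(G\times\widehat{G})}\to\mathbb{C}^{o(G)}$, $V_\tau(a_\lambda)_{\lambda\in G\times\widehat{G}}=\sum_{\lambda\in G\times\widehat{G}}a_\lambda\pi(\lambda)\tau$. *)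

theory Defs
  imports "HOL-Analysis.Analysis"
begin

text \<open>
  A finite abelian group \<open>G\<close> is a type \<open>'g\<close> of sort \<open>{finite, ab_group_add}\<close>, so that
  \<open>o(G)\<close> is \<open>CARD('g)\<close> and the space of vectors indexed by \<open>G\<close> is \<open>complex ^ 'g\<close>.
  The characters (homomorphisms into the unit circle) form a type as well, because the pairs
  \<open>(k, \<xi>)\<close> have to serve as indices of vectors.
\<close>

typedef (overloaded) ('g::ab_group_add) "character" =
  "{\<eta> :: 'g \<Rightarrow> complex. (\<forall>x. norm (\<eta> x) = 1) \<and> (\<forall>x y. \<eta> (x + y) = \<eta> x * \<eta> y)}"
  morphisms char_fun Abs_character
  by (rule exI[of _ "\<lambda>_. 1"]) simp

lemma norm_char_fun [simp]: "norm (char_fun \<xi> x) = 1"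
  using char_fun[of \<xi>] by simp

lemma char_fun_nonzero [simp]: "char_fun \<xi> x \<noteq> 0"
  by (metis norm_char_fun norm_zero zero_neq_one)

lemma char_fun_add: "char_fun \<xi> (x + y) = char_fun \<xi> x * char_fun \<xi> y"
  using char_fun[of \<xi>] by simp

lemma char_fun_power_card:
  fixes \<xi> :: "('g::{finite, ab_group_add}) character"
  shows "char_fun \<xi> x ^ CARD('g) = 1"
proof -
  have "(\<Prod>y\<in>UNIV. char_fun \<xi> y) = (\<Prod>y\<in>UNIV. char_fun \<xi> (x + y))"
    by (rule prod.reindex_bij_betw[symmetric]) (simp add: bij_plus_right)
  also have "\<dots> = char_fun \<xi> x ^ CARD('g) * (\<Prod>y\<in>UNIV. char_fun \<xi> y)"
    by (simp add: char_fun_add prod.distrib)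
  finally show ?thesis
    by simp
qed

instance "character" :: ("{finite, ab_group_add}") finite
proof
  let ?R = "{z :: complex. z ^ CARD('a) = 1}"
  have "finite ?R"
    by (rule finite_roots_unity) (simp add: Suc_leI)
  hence "finite (PiE (UNIV :: 'a set) (\<lambda>_. ?R))"
    by (intro finite_PiE) simp_all
  moreover have "range (char_fun :: 'a character \<Rightarrow> _) \<subseteq> PiE UNIV (\<lambda>_. ?R)"
    by (auto simp: char_fun_power_card)
  ultimately have "finite (range (char_fun :: 'a character \<Rightarrow> _))"
    by (rule finite_subset[rotated])
  thus "finite (UNIV :: 'a character set)"
    by (rule finite_imageD) (simp add: inj_on_def char_fun_inject)
qed

text \<open>
  The types below are written \<open>(complex, 'i) vec\<close>, i.e. \<open>complex ^ 'i\<close>, since the infix form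
  attaches its own sort constraint to an unannotated index variable.
\<close>

definition tf_shift ::
  "('g::{finite, ab_group_add}) \<times> 'g character \<Rightarrow> (complex, 'g) vec \<Rightarrow> (complex, 'g) vec" where
  "tf_shift l x = (\<chi> g. char_fun (snd l) g * x $ (g - fst l))"

text \<open>This makes \<open>inv (tf_shift l)\<close> below the genuine inverse operator.\<close>

lemma bij_tf_shift: "bij (tf_shift l)"
proof (rule o_bij)
  let ?h = "\<lambda>y. \<chi> g. y $ (g + fst l) / char_fun (snd l) (g + fst l)"
  show "?h \<circ> tf_shift l = id" "tf_shift l \<circ> ?h = id"
    by (auto simp: fun_eq_iff vec_eq_iff tf_shift_def)
qed

definition analysis_op ::
  "((complex, 'g::{finite, ab_group_add}) vec \<Rightarrow> complex) \<Rightarrow> (complex, 'g) vec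
    \<Rightarrow> (complex, 'g \<times> 'g character) vec" where
  "analysis_op f x = (\<chi> l. f (inv (tf_shift l) x))"

definition synthesis_op ::
  "(complex, 'g::{finite, ab_group_add}) vec \<Rightarrow> (complex, 'g \<times> 'g character) vec
    \<Rightarrow> (complex, 'g) vec" where
  "synthesis_op \<tau> a = (\<Sum>l\<in>UNIV. a $ l *s tf_shift l \<tau>)"

end

theory Submission
  imports Defs
begin

text \<open>
  Writing \<open>f y = (\<Sum>h. y\<^sub>h * c\<^sub>h)\<close> and \<open>\<pi>(k, \<xi>)\<inverse> x = (x\<^bsub>h+k\<^esub> / \<xi>(h + k))\<^sub>h\<close>, the entry at \<open>g\<close> of
  the vector that analysis followed by synthesis makes of \<open>x\<close> is
  \<open>\<Sum>k. \<Sum>h. c\<^sub>h * x\<^bsub>h+k\<^esub> * \<tau>\<^bsub>g-k\<^esub> * (\<Sum>\<xi>. \<xi>(g - (h + k)))\<close>.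
  The sum over all characters at a point \<open>z\<close> is \<open>o(G)\<close> for \<open>z = 0\<close> and vanishes otherwise
  (\<open>sum_characters\<close>), so that only \<open>h = g - k\<close> survives and the entry equals
  \<open>o(G) * x\<^sub>g * (\<Sum>h. c\<^sub>h * \<tau>\<^sub>h) = o(G) * x\<^sub>g * f \<tau>\<close>.

  The substance of this dual orthogonality relation is that \<open>G\<close> has enough characters to
  separate points (\<open>characters_separate\<close>). The argument is spectral: translation by \<open>y\<close> has
  finite order, so every function on \<open>G\<close> is a sum of eigenfunctions of it, namely of the twisted
  averages of the function along the multiples of \<open>y\<close>. Translations commute, and hence
  averaging preserves the eigenfunction property for other translations. By induction every function
  is a sum of joint eigenfunctions of all translations, and these are the multiples of the
  characters. Points on which all characters agree are thus not separated by any function.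
\<close>

section \<open>Translations and their eigenfunctions\<close>

text \<open>
  The multiple \<open>j \<cdot> y\<close> in a commutative additive group is written \<open>\<Sum>i<j. y\<close>. The sum of all
  group elements does not change when each of them is shifted by \<open>y\<close>, which gives Lagrange's
  theorem in the following form.
\<close>
lemma card_multiple_eq_0:
  fixes y :: "'g::{finite, ab_group_add}"
  shows "(\<Sum>i<CARD('g). y) = 0"
proof -
  have "(\<Sum>x\<in>(UNIV::'g set). x) = (\<Sum>x\<in>(UNIV::'g set). y + x)"
    by (rule sum.reindex_bij_betw[symmetric]) (simp add: bij_plus_right)
  hence "(\<Sum>x\<in>(UNIV::'g set). y) = 0"
    by (simp add: sum.distrib)
  moreover obtain b :: "nat \<Rightarrow> 'g" where "bij_betw b {..<CARD('g)} UNIV"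
    using ex_bij_betw_nat_finite[OF finite_class.finite_UNIV] by (auto simp: atLeast0LessThan)
  ultimately show ?thesis
    using sum.reindex_bij_betw[of b "{..<CARD('g)}" UNIV "\<lambda>_. y"] by simp
qed

lemma sum_powers_root_of_unity:
  fixes w :: "'a::field"
  assumes "w ^ n = 1" "w \<noteq> 1"
  shows "(\<Sum>i<n. w ^ i) = 0"
  using assms by (simp add: sum_gp_strict)

definition shift_eigenfun :: "('g::ab_group_add) set \<Rightarrow> ('g \<Rightarrow> complex) \<Rightarrow> bool" where
  "shift_eigenfun A u \<longleftrightarrow> (\<forall>y\<in>A. \<exists>c. \<forall>x. u (x + y) = c * u x)"

text \<open>Up to a scalar, this is the projection onto the functions that translation by \<open>y\<close> multiplies
  by \<open>inverse w\<close>, for \<open>w\<close> a root of unity of order dividing \<open>o(G)\<close>.\<close>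
definition twisted_average ::
  "complex \<Rightarrow> 'g::{finite, ab_group_add} \<Rightarrow> ('g \<Rightarrow> complex) \<Rightarrow> 'g \<Rightarrow> complex" where
  "twisted_average w y u x = (\<Sum>j<CARD('g). w ^ j * u (x + (\<Sum>i<j. y)))"

lemma twisted_average_shift:
  fixes y :: "'g::{finite, ab_group_add}"
  assumes w: "w ^ CARD('g) = 1"
  shows "w * twisted_average w y u (x + y) = twisted_average w y u x"
proof -
  let ?F = "\<lambda>j. w ^ j * u (x + (\<Sum>i<j. y))"
  have "w * twisted_average w y u (x + y) = (\<Sum>j<CARD('g). ?F (Suc j))"
    unfolding twisted_average_def sum_distrib_left
    by (rule sum.cong) (simp_all add: algebra_simps)
  \<comment> \<open>The sum is cyclic, since the terms number \<open>0\<close> and \<open>o(G)\<close> agree.\<close>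
  also have "\<dots> = (\<Sum>j<CARD('g). ?F j)"
  proof -
    have "?F (CARD('g)) = ?F 0"
      by (simp add: w card_multiple_eq_0)
    thus ?thesis
      using sum.lessThan_Suc_shift[of ?F "CARD('g)"] sum.lessThan_Suc[of ?F "CARD('g)"]
      by (simp add: o_def)
  qed
  finally show ?thesis
    by (simp add: twisted_average_def)
qed

lemma shift_eigenfun_twisted_average:
  fixes y :: "'g::{finite, ab_group_add}"
  assumes w: "w ^ CARD('g) = 1" and u: "shift_eigenfun A u"
  shows "shift_eigenfun (insert y A) (twisted_average w y u)"
proof -
  have "w \<noteq> 0"
    using w by (auto simp: zero_power)
  hence "twisted_average w y u (x + y) = inverse w * twisted_average w y u x" for x
    using twisted_average_shift[OF w, of y u x] by (simp add: field_simps)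
  moreover have "\<exists>c. \<forall>x. twisted_average w y u (x + z) = c * twisted_average w y u x"
    if "z \<in> A" for z
  proof -
    obtain c where c: "u (x + z) = c * u x" for x
      using u \<open>z \<in> A\<close> unfolding shift_eigenfun_def by blast
    have "u (x + z + s) = c * u (x + s)" for x s
      using c[of "x + s"] by (simp add: algebra_simps)
    thus ?thesis
      by (auto simp: twisted_average_def sum_distrib_left mult_ac)
  qed
  ultimately show ?thesis
    by (auto simp: shift_eigenfun_def)
qed

text \<open>
  Summed over all roots of unity \<open>w\<close>, the weights \<open>w ^ j\<close> of the terms with \<open>j > 0\<close> cancel,
  which leaves a multiple of the function itself.
\<close>
lemma sum_twisted_averages:
  fixes y :: "'g::{finite, ab_group_add}"
  defines "\<zeta> \<equiv> exp (2 * of_real pi * \<i> / of_nat CARD('g))"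
  shows "\<zeta> ^ CARD('g) = 1"
    and "(\<Sum>m<CARD('g). twisted_average (\<zeta> ^ m) y u x) = of_nat CARD('g) * u x"
proof -
  let ?n = "CARD('g)"
  have pow: "\<zeta> ^ j = exp (2 * of_real pi * \<i> * of_nat j / of_nat ?n)" for j
    by (simp add: \<zeta>_def flip: exp_of_nat_mult) (simp add: mult_ac)
  show root: "\<zeta> ^ ?n = 1"
    by (simp add: pow)
  have neq: "\<zeta> ^ j \<noteq> 1" if "0 < j" "j < ?n" for j
    using complex_root_unity_eq_1[of ?n j] that
    by (auto simp: pow dest: dvd_imp_le)
  have "(\<Sum>m<?n. (\<zeta> ^ j) ^ m) = (if j = 0 then of_nat ?n else 0)" if "j < ?n" for j
  proof -
    have "(\<zeta> ^ j) ^ ?n = 1"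
      by (metis root power_mult mult.commute power_one)
    thus ?thesis
      using neq[of j] that sum_powers_root_of_unity[of "\<zeta> ^ j" ?n] by auto
  qed
  hence weight: "(\<Sum>m<?n. (\<zeta> ^ m) ^ j) = (if j = 0 then of_nat ?n else 0)" if "j < ?n" for j
    using that by (metis (no_types, lifting) sum.cong mult.commute power_mult)
  have "(\<Sum>m<?n. twisted_average (\<zeta> ^ m) y u x)
      = (\<Sum>j<?n. (\<Sum>m<?n. (\<zeta> ^ m) ^ j) * u (x + (\<Sum>i<j. y)))"
    unfolding twisted_average_def sum_distrib_right by (rule sum.swap)
  also have "\<dots> = (\<Sum>j<?n. if j = 0 then of_nat ?n * u x else 0)"
    by (rule sum.cong) (simp_all add: weight)
  also have "\<dots> = of_nat ?n * u x"
    by simp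
  finally show "(\<Sum>m<?n. twisted_average (\<zeta> ^ m) y u x) = of_nat ?n * u x" .
qed

text \<open>
  This expresses, without naming a decomposition, that every function is a sum of joint
  eigenfunctions: the linear condition \<open>u a = u b\<close> passes from the summands to the sum.
\<close>
lemma shift_eigenfuns_separate:
  fixes a b :: "'g::{finite, ab_group_add}" and u :: "'g \<Rightarrow> complex"
  assumes "\<And>u. shift_eigenfun A u \<Longrightarrow> u a = u b"
  shows "u a = u b"
proof -
  have "finite A"
    by simp
  thus ?thesis
    using assms
  proof (induction A arbitrary: u)
    case empty
    show ?case
      by (rule empty) (simp add: shift_eigenfun_def)
  next
    case (insert y A)
    have "v a = v b" if v: "shift_eigenfun A v" for v
    proof -
      define \<zeta> where "\<zeta> = exp (2 * of_real pi * \<i> / of_nat CARD('g))"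
      note \<zeta> = sum_twisted_averages[where 'g = 'g, folded \<zeta>_def]
      have "(\<zeta> ^ m) ^ CARD('g) = 1" for m
        by (metis \<zeta>(1) mult.commute power_mult power_one)
      hence "twisted_average (\<zeta> ^ m) y v a = twisted_average (\<zeta> ^ m) y v b" for m
        by (intro insert.prems shift_eigenfun_twisted_average v)
      hence "of_nat CARD('g) * v a = of_nat CARD('g) * v b"
        by (simp flip: \<zeta>(2)[of y])
      thus ?thesis
        by simp
    qed
    thus ?case
      by (rule insert.IH)
  qed
qed

section \<open>Characters of a finite abelian group\<close>

lemma ex_character:
  fixes \<eta> :: "'g::{finite, ab_group_add} \<Rightarrow> complex"
  assumes zero: "\<eta> 0 = 1" and add: "\<And>x y. \<eta> (x + y) = \<eta> x * \<eta> y"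
  obtains \<xi> where "char_fun \<xi> = \<eta>"
proof -
  have "norm (\<eta> y) = 1" for y
  proof -
    have "\<eta> (\<Sum>i<j. y) = \<eta> y ^ j" for j :: nat
      by (induction j) (simp_all add: zero add)
    hence "\<eta> y ^ CARD('g) = 1"
      by (metis card_multiple_eq_0 zero)
    thus ?thesis
      using power_eq_1_iff by fastforce
  qed
  thus ?thesis
    using that[of "Abs_character \<eta>"] add by (simp add: Abs_character_inverse)
qed

lemma shift_eigenfun_UNIV_obtain_character:
  fixes u :: "'g::{finite, ab_group_add} \<Rightarrow> complex"
  assumes "shift_eigenfun UNIV u"
  obtains \<xi> where "\<And>x. u x = u 0 * char_fun \<xi> x"
proof -
  obtain \<eta> where \<eta>: "u (x + y) = \<eta> y * u x" for x y
    using assms unfolding shift_eigenfun_def by (metis UNIV_I)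
  have u: "u y = \<eta> y * u 0" for y
    using \<eta>[of 0 y] by simp
  show ?thesis
  proof (cases "u 0 = 0")
    case True
    thus ?thesis
      using that u by (metis mult_zero_left mult_zero_right)
  next
    case False
    have "\<eta> 0 = 1"
      using u[of 0] False by simp
    moreover have "\<eta> (x + y) = \<eta> x * \<eta> y" for x y
      using \<eta>[of x y] u[of "x + y"] u[of x] False by (simp add: mult_ac)
    ultimately obtain \<xi> where "char_fun \<xi> = \<eta>"
      by (rule ex_character)
    thus ?thesis
      using that[of \<xi>] u by (metis mult.commute)
  qed
qed

text \<open>If all characters took the value 1 at \<open>z\<close>, the indicator of 0 could not tell \<open>z\<close> from 0.\<close>
lemma characters_separate:
  fixes z :: "'g::{finite, ab_group_add}"
  assumes "z \<noteq> 0"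
  obtains \<xi> where "char_fun \<xi> z \<noteq> 1"
proof (rule ccontr)
  assume "\<not> thesis"
  hence one: "char_fun \<xi> z = 1" for \<xi>
    using that by blast
  have "v z = v 0" if "shift_eigenfun UNIV v" for v
    using shift_eigenfun_UNIV_obtain_character[OF that] one by (metis mult.right_neutral)
  hence "(\<lambda>x. of_bool (x = 0) :: complex) z = of_bool ((0::'g) = 0)"
    by (rule shift_eigenfuns_separate)
  thus False
    using assms by simp
qed

lemma char_fun_0 [simp]: "char_fun \<xi> 0 = 1"
  using char_fun_add[of \<xi> 0 0] by simp

lemma char_fun_diff: "char_fun \<xi> (x - y) = char_fun \<xi> x / char_fun \<xi> y"
  using char_fun_add[of \<xi> "x - y" y] by (simp add: eq_divide_eq)

lemma character_product:
  fixes \<xi> \<psi> :: "('g::{finite, ab_group_add}) character"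
  obtains \<rho> where "\<And>x. char_fun \<rho> x = char_fun \<xi> x * char_fun \<psi> x"
  using ex_character[of "\<lambda>x. char_fun \<xi> x * char_fun \<psi> x"]
  by (auto simp: char_fun_add mult_ac fun_eq_iff)

text \<open>Multiplication by a fixed character permutes the dual group.\<close>
lemma sum_characters_nonzero:
  fixes z :: "'g::{finite, ab_group_add}"
  assumes "z \<noteq> 0"
  shows "(\<Sum>\<xi>\<in>UNIV. char_fun \<xi> z) = 0"
proof -
  obtain \<psi> where \<psi>: "char_fun \<psi> z \<noteq> 1"
    using assms by (rule characters_separate)
  have "\<forall>\<xi>. \<exists>\<rho>. \<forall>x. char_fun \<rho> x = char_fun \<psi> x * char_fun \<xi> x"
    using character_product[of \<psi>] by meson
  then obtain p where p: "char_fun (p \<xi>) x = char_fun \<psi> x * char_fun \<xi> x" for \<xi> x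
    by metis
  have "inj p"
  proof (rule injI)
    fix \<xi> \<rho> assume "p \<xi> = p \<rho>"
    hence "char_fun \<psi> x * char_fun \<xi> x = char_fun \<psi> x * char_fun \<rho> x" for x
      by (metis p)
    thus "\<xi> = \<rho>"
      by (simp add: fun_eq_iff flip: char_fun_inject)
  qed
  hence "bij p"
    by (simp add: bij_def finite_UNIV_inj_surj)
  hence "(\<Sum>\<xi>\<in>UNIV. char_fun \<xi> z) = (\<Sum>\<xi>\<in>UNIV. char_fun (p \<xi>) z)"
    by (rule sum.reindex_bij_betw[symmetric])
  also have "\<dots> = char_fun \<psi> z * (\<Sum>\<xi>\<in>UNIV. char_fun \<xi> z)"
    by (simp add: p sum_distrib_left)
  finally show ?thesis
    using \<psi> by simp
qed

lemma sum_char_fun: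
  fixes \<xi> :: "('g::{finite, ab_group_add}) character"
  shows "(\<Sum>x\<in>UNIV. char_fun \<xi> x) = (if \<forall>x. char_fun \<xi> x = 1 then of_nat CARD('g) else 0)"
proof (cases "\<forall>x. char_fun \<xi> x = 1")
  case False
  then obtain y where y: "char_fun \<xi> y \<noteq> 1"
    by blast
  have "(\<Sum>x\<in>UNIV. char_fun \<xi> x) = (\<Sum>x\<in>UNIV. char_fun \<xi> (y + x))"
    by (rule sum.reindex_bij_betw[symmetric]) (simp add: bij_plus_right)
  also have "\<dots> = char_fun \<xi> y * (\<Sum>x\<in>UNIV. char_fun \<xi> x)"
    by (simp add: char_fun_add sum_distrib_left)
  finally show ?thesis
    using y False by simp
qed simp

text \<open>
  The sum of all values of all characters is evaluated in two ways: summing over the characters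
  first leaves the point 0, summing over the points first leaves the trivial character.
\<close>
lemma card_characters:
  "CARD(('g::{finite, ab_group_add}) character) = CARD('g)"
proof -
  obtain \<epsilon> :: "'g character" where \<epsilon>: "char_fun \<epsilon> = (\<lambda>_. 1)"
    by (rule ex_character[of "\<lambda>_. 1"]) simp_all
  have trivial: "(\<forall>x. char_fun \<xi> x = 1) \<longleftrightarrow> \<xi> = \<epsilon>" for \<xi>
    using \<epsilon> by (auto simp: fun_eq_iff simp flip: char_fun_inject)
  have "(of_nat CARD('g character) :: complex)
      = (\<Sum>x\<in>(UNIV::'g set). if x = 0 then of_nat CARD('g character) else 0)"
    by simp
  also have "\<dots> = (\<Sum>x\<in>UNIV. \<Sum>\<xi>\<in>(UNIV::'g character set). char_fun \<xi> x)"
    by (rule sum.cong) (simp_all add: sum_characters_nonzero)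
  also have "\<dots> = (\<Sum>\<xi>\<in>(UNIV::'g character set). \<Sum>x\<in>UNIV. char_fun \<xi> x)"
    by (rule sum.swap)
  also have "\<dots> = of_nat CARD('g)"
    by (simp add: sum_char_fun trivial)
  finally show ?thesis
    by (simp only: of_nat_eq_iff)
qed

lemma sum_characters:
  fixes z :: "'g::{finite, ab_group_add}"
  shows "(\<Sum>\<xi>\<in>UNIV. char_fun \<xi> z) = (if z = 0 then of_nat CARD('g) else 0)"
  by (simp add: sum_characters_nonzero card_characters)

section \<open>Time-frequency analysis and synthesis\<close>

lemma inv_tf_shift_nth:
  "inv (tf_shift (k, \<xi>)) x $ h = x $ (h + k) / char_fun \<xi> (h + k)"
proof -
  have "tf_shift (k, \<xi>) (\<chi> h. x $ (h + k) / char_fun \<xi> (h + k)) = x"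
    by (simp add: vec_eq_iff tf_shift_def)
  hence "inv (tf_shift (k, \<xi>)) x = (\<chi> h. x $ (h + k) / char_fun \<xi> (h + k))"
    by (rule inv_f_eq[OF bij_is_inj[OF bij_tf_shift]])
  thus ?thesis
    by simp
qed

lemma linear_functional_expansion:
  fixes f :: "complex ^ 'n \<Rightarrow> complex"
  assumes "Vector_Spaces.linear (*s) (*) f"
  shows "f y = (\<Sum>h\<in>UNIV. y $ h * f (axis h 1))"
proof -
  interpret f: Vector_Spaces.linear "(*s)" "(*)" f
    by fact
  have "f y = f (\<Sum>h\<in>UNIV. y $ h *s axis h 1)"
    by (simp only: basis_expansion)
  also have "\<dots> = (\<Sum>h\<in>UNIV. y $ h * f (axis h 1))"
    by (simp only: f.sum f.scale)
  finally show ?thesis .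
qed

theorem theorem3p3:
  fixes f :: "complex ^ ('g::{finite, ab_group_add}) \<Rightarrow> complex"
    and \<tau> :: "complex ^ ('g::{finite, ab_group_add})"
  assumes "Vector_Spaces.linear (*s) (*) f"
  shows "synthesis_op \<tau> \<circ> analysis_op f = (\<lambda>x. (of_nat CARD('g) * f \<tau>) *s id x)"
proof -
  define c where "c h = f (axis h 1)" for h
  have f: "f y = (\<Sum>h\<in>UNIV. y $ h * c h)" for y
    unfolding c_def by (rule linear_functional_expansion[OF assms])
  have "synthesis_op \<tau> (analysis_op f x) $ g = of_nat CARD('g) * f \<tau> * x $ g" for x g
  proof -
    have "synthesis_op \<tau> (analysis_op f x) $ g
        = (\<Sum>l\<in>UNIV. f (inv (tf_shift l) x) * (char_fun (snd l) g * \<tau> $ (g - fst l)))"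
      by (simp add: synthesis_op_def analysis_op_def tf_shift_def)
    also have "\<dots> = (\<Sum>k\<in>UNIV. \<Sum>\<xi>\<in>UNIV.
        f (inv (tf_shift (k, \<xi>)) x) * (char_fun \<xi> g * \<tau> $ (g - k)))"
      by (simp add: sum.cartesian_product case_prod_unfold flip: UNIV_Times_UNIV)
    also have "\<dots> = (\<Sum>k\<in>UNIV. of_nat CARD('g) * x $ g * (c (g - k) * \<tau> $ (g - k)))"
    proof (rule sum.cong[OF refl])
      fix k
      have "(\<Sum>\<xi>\<in>UNIV. f (inv (tf_shift (k, \<xi>)) x) * (char_fun \<xi> g * \<tau> $ (g - k)))
          = (\<Sum>\<xi>\<in>UNIV. \<Sum>h\<in>UNIV.
              c h * x $ (h + k) * \<tau> $ (g - k) * char_fun \<xi> (g - (h + k)))"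
        unfolding f sum_distrib_right
        by (simp add: inv_tf_shift_nth char_fun_diff mult_ac)
      also have "\<dots> = (\<Sum>h\<in>UNIV. c h * x $ (h + k) * \<tau> $ (g - k)
          * (\<Sum>\<xi>\<in>UNIV. char_fun \<xi> (g - (h + k))))"
        unfolding sum_distrib_left by (rule sum.swap)
      also have "\<dots> = (\<Sum>h\<in>UNIV.
          if h = g - k then of_nat CARD('g) * x $ g * (c (g - k) * \<tau> $ (g - k)) else 0)"
        by (rule sum.cong) (auto simp: sum_characters algebra_simps)
      also have "\<dots> = of_nat CARD('g) * x $ g * (c (g - k) * \<tau> $ (g - k))"
        by simp
      finally show "(\<Sum>\<xi>\<in>UNIV. f (inv (tf_shift (k, \<xi>)) x) * (char_fun \<xi> g * \<tau> $ (g - k)))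
          = of_nat CARD('g) * x $ g * (c (g - k) * \<tau> $ (g - k))" .
    qed
    also have "\<dots> = of_nat CARD('g) * x $ g * (\<Sum>k\<in>UNIV. c (g - k) * \<tau> $ (g - k))"
      by (simp add: sum_distrib_left)
    also have "(\<Sum>k\<in>UNIV. c (g - k) * \<tau> $ (g - k)) = (\<Sum>h\<in>UNIV. c h * \<tau> $ h)"
    proof (rule sum.reindex_bij_betw)
      show "bij (\<lambda>k. g - k)"
        by (rule o_bij[of "\<lambda>k. g - k"]) (auto simp: fun_eq_iff)
    qed
    finally show ?thesis
      by (simp add: f[of \<tau>] mult_ac)
  qed
  thus ?thesis
    by (simp add: fun_eq_iff vec_eq_iff)
qed

end
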